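(* Let $a>e$ be a real number. There exist infinite sequences $\varepsilon$ of signs $+,-$ for which the sequence $(u_{n,\varepsilon})_n$ converges in $\overline{\mathbb{R}}$ and others for which it diverges (has no limit in $\overline{\mathbb{R}}$). Likewise, there exist elements of $\overline{\mathbb{R}}$ which are representable and others which are not. In particular, $a$ is not suitable.
   Context: $\overline{\mathbb{R}}=[-\infty,+\infty]$ is the extended real line with its usual order topology; convergence is in $\overline{\mathbb{R}}$ (infinite limits allowed). For a fixed real $a>0$ define $f_+,f_-:\overline{\mathbb{R}}\to\overline{\mathbb{R}}$ by $f_+(x)=e^{ax}$ and $f_-(x)=-e^{ax}$, with $e^{-\infty}=0$, $e^{+\infty}=+\infty$. For an infinite sequence $\varepsilon=(\varepsilon_1,\varepsilon_2,\ldots)$ of signs $+$ and $-$ and $n\ge 0$, put $f_{n,\varepsilon}=f_{\varepsilon_1}\circ f_{\varepsilon_2}\circ\cdots\circ f_{\varepsilon_n}$ ($f_{0,\varepsilon}$ is the identity) and $u_{n,\varepsilon}=f_{n,\varepsilon}(1)$. The sequence $\varepsilon$ represents $t\in\overline{\mathbb{R}}$ if $u_{n,\varepsilon}\to t$ in $\overline{\mathbb{R}}$ as $n\to\infty$; $t\in\overline{\mathbb{R}}$ is representable if some $\varepsilon$ represents it. The number $a$ is suitable if every infinite sequence $\varepsilon$ represents an element of $\overline{\mathbb{R}}$ and every element of $\overline{\mathbb{R}}$ is representable. *)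

theory Defs
  imports "HOL-Analysis.Analysis"
begin

function exp_ereal :: "ereal \<Rightarrow> ereal" where
  "exp_ereal (ereal r) = ereal (exp r)"
| "exp_ereal \<infinity> = \<infinity>"
| "exp_ereal (-\<infinity>) = 0"
  by (auto intro: ereal_cases)
termination by standard (rule wf_on_bot)

datatype sign = Plus | Minus

primrec f_sign :: "real \<Rightarrow> sign \<Rightarrow> ereal \<Rightarrow> ereal" where
  "f_sign a Plus x = exp_ereal (ereal a * x)"
| "f_sign a Minus x = - exp_ereal (ereal a * x)"

(* Sign sequences are indexed from 0: \<epsilon> k is the (k+1)-st sign.
   The newest sign is applied innermost. *)
primrec f_comp :: "real \<Rightarrow> (nat \<Rightarrow> sign) \<Rightarrow> nat \<Rightarrow> ereal \<Rightarrow> ereal" where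
  "f_comp a \<epsilon> 0 = id"
| "f_comp a \<epsilon> (Suc n) = f_comp a \<epsilon> n \<circ> f_sign a (\<epsilon> n)"

definition u :: "real \<Rightarrow> (nat \<Rightarrow> sign) \<Rightarrow> nat \<Rightarrow> ereal" where
  "u a \<epsilon> n = f_comp a \<epsilon> n 1"

definition represents :: "real \<Rightarrow> (nat \<Rightarrow> sign) \<Rightarrow> ereal \<Rightarrow> bool" where
  "represents a \<epsilon> t \<longleftrightarrow> u a \<epsilon> \<longlonglongrightarrow> t"

definition representable :: "real \<Rightarrow> ereal \<Rightarrow> bool" where
  "representable a t \<longleftrightarrow> (\<exists>\<epsilon>. represents a \<epsilon> t)"

definition suitable :: "real \<Rightarrow> bool" where
  "suitable a \<longleftrightarrow> (\<forall>\<epsilon>. \<exists>t. represents a \<epsilon> t) \<and> (\<forall>t. representable a t)"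

end

theory Submission
  imports Defs
begin

text \<open>
  The constant sequence of plus signs gives an increasing, hence convergent, sequence. For minus
  signs, \<open>x \<mapsto> - exp (a * x)\<close> exchanges the half-lines \<open>[-1/a, \<infinity>]\<close> and \<open>[-\<infinity>, -1/e]\<close>, because
  \<open>ln a \<le> a / e\<close>; these are disjoint for \<open>a > e\<close>, so the sequence oscillates between them. Finally,
  the fixed point of \<open>x \<mapsto> - exp (a * x)\<close> is not representable: being negative, it forces the first
  sign to be a minus, and the shifted sequence again represents it, so all signs are minus.
\<close>

lemma strict_mono_exp_ereal: "strict_mono exp_ereal"
proof (rule strict_monoI)
  fix x y :: ereal
  assume "x < y"
  then show "exp_ereal x < exp_ereal y"
    by (cases x; cases y) auto
qed

lemma exp_ereal_nonneg: "0 \<le> exp_ereal x"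
  by (cases x) auto

lemma f_sign_Plus_mono:
  assumes "a > 0" "x \<le> y"
  shows "f_sign a Plus x \<le> f_sign a Plus y"
  using assms
  by (simp add: strict_mono_less_eq[OF strict_mono_exp_ereal] ereal_mult_left_mono)

lemma f_sign_Minus_le_iff:
  assumes "a > 0"
  shows "f_sign a Minus x \<le> f_sign a Minus y \<longleftrightarrow> y \<le> x"
  using assms
  by (simp add: strict_mono_less_eq[OF strict_mono_exp_ereal] ereal_mult_le_mult_iff)

lemma f_sign_Minus_less_iff:
  assumes "a > 0"
  shows "f_sign a Minus x < f_sign a Minus y \<longleftrightarrow> y < x"
  using f_sign_Minus_le_iff[OF assms, of y x] by (simp flip: not_le)

text \<open>\<open>f_comp\<close> adds new signs innermost; by associativity the outermost sign can
  be split off instead. This turns \<open>u\<close> into a recursion over the shifted sign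
  sequence.\<close>

lemma f_comp_Suc_shift:
  "f_comp a \<epsilon> (Suc n) = f_sign a (\<epsilon> 0) \<circ> f_comp a (\<lambda>k. \<epsilon> (Suc k)) n"
  by (induction n) (simp, metis comp_assoc f_comp.simps(2))

lemma u_0: "u a \<epsilon> 0 = 1"
  by (simp add: u_def)

lemma u_Suc: "u a \<epsilon> (Suc n) = f_sign a (\<epsilon> 0) (u a (\<lambda>k. \<epsilon> (Suc k)) n)"
  unfolding u_def f_comp_Suc_shift by simp

text \<open>The first step is \<open>1 \<le> exp a\<close>, and monotonicity propagates it. An
  increasing sequence in \<open>ereal\<close> tends to its supremum, possibly \<infinity>.\<close>

lemma convergent_u_Plus:
  assumes "a > 0"
  shows "convergent (u a (\<lambda>_. Plus))"
proof -
  have "u a (\<lambda>_. Plus) n \<le> u a (\<lambda>_. Plus) (Suc n)" for n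
  proof (induction n)
    case 0
    then show ?case using assms by (simp add: u_Suc u_0 one_ereal_def)
  next
    case (Suc n)
    from f_sign_Plus_mono[OF assms Suc] show ?case by (simp only: u_Suc)
  qed
  then show ?thesis
    by (intro convergentI[OF LIMSEQ_SUP] incseq_SucI)
qed

lemma not_convergent_u_Minus:
  assumes "a > exp 1"
  shows "\<not> convergent (u a (\<lambda>_. Minus))"
proof
  let ?v = "u a (\<lambda>_. Minus)"
  \<comment> \<open>\<open>d\<close> is the point that \<open>f_sign a Minus\<close> sends to
    \<open>c\<close>; the gap \<open>c < d\<close> is exactly \<open>a > exp 1\<close>.\<close>
  define c d where "c = ereal (- exp (- 1))" and "d = ereal (- 1 / a)"
  have a: "a > 0" using assms exp_gt_zero less_trans by blast
  have "c < d"
    using assms a by (simp add: c_def d_def exp_minus field_simps)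
  have fd: "f_sign a Minus d = c"
    using a by (simp add: c_def d_def)
  have fc: "d \<le> f_sign a Minus c"
  proof -
    \<comment> \<open>This is \<open>exp 1 * y \<le> exp y\<close> at
      \<open>y = a * exp (- 1)\<close>, obtained from \<open>1 + z \<le> exp z\<close> at
      \<open>z = y - 1\<close>.\<close>
    have "a = exp 1 * (a * exp (- 1))"
      by (simp add: exp_minus field_simps)
    also have "\<dots> \<le> exp 1 * exp (a * exp (- 1) - 1)"
      using exp_ge_add_one_self[of "a * exp (- 1) - 1"] by simp
    also have "\<dots> = exp (a * exp (- 1))"
      by (simp flip: exp_add)
    finally have "exp (- (a * exp (- 1))) \<le> 1 / a"
      using a by (simp add: exp_minus field_simps)
    then show ?thesis by (simp add: c_def d_def)
  qed
  have even: "d \<le> ?v (2 * n)" for n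
  proof (induction n)
    case 0
    have "- 1 / a \<le> 1" using a by (simp add: field_simps)
    then show ?case by (simp add: u_0 d_def one_ereal_def)
  next
    case (Suc n)
    then have "f_sign a Minus (?v (2 * n)) \<le> c"
      using f_sign_Minus_le_iff[OF a] fd by metis
    then have "f_sign a Minus c \<le> f_sign a Minus (f_sign a Minus (?v (2 * n)))"
      using f_sign_Minus_le_iff[OF a] by metis
    with fc have "d \<le> f_sign a Minus (f_sign a Minus (?v (2 * n)))"
      by (rule order_trans)
    then show ?case by (simp only: mult_Suc_right add_2_eq_Suc u_Suc)
  qed
  have odd: "?v (Suc (2 * n)) \<le> c" for n
    using even[of n] f_sign_Minus_le_iff[OF a] fd unfolding u_Suc by metis
  assume "convergent ?v"
  then obtain L where L: "?v \<longlonglongrightarrow> L" by (auto simp: convergent_def)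
  have "d \<le> L"
    using LIMSEQ_subseq_LIMSEQ[OF L, of "\<lambda>n. 2 * n"] even
    by (intro LIMSEQ_le_const) (auto simp: strict_mono_def o_def)
  moreover have "L \<le> c"
    using LIMSEQ_subseq_LIMSEQ[OF L, of "\<lambda>n. Suc (2 * n)"] odd
    by (intro LIMSEQ_le_const2) (auto simp: strict_mono_def o_def)
  ultimately show False using \<open>c < d\<close> by simp
qed

lemma f_sign_Minus_fixpoint:
  assumes "a > 0"
  obtains p where "p < 0" "f_sign a Minus p = p"
proof -
  \<comment> \<open>\<open>x + exp (a * x)\<close> equals \<open>exp (- a) - 1 \<le> 0\<close> at -1
    and 1 at 0.\<close>
  have "\<exists>x\<ge>-1. x \<le> 0 \<and> x + exp (a * x) = 0"
    using assms by (intro IVT') (auto intro!: continuous_intros)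
  then obtain x where "x = - exp (a * x)"
    by (auto simp: add_eq_0_iff2)
  moreover from this have "x < 0"
    by (metis exp_gt_zero neg_less_0_iff_less)
  ultimately show thesis
    by (intro that[of "ereal x"]) simp_all
qed

text \<open>Since \<open>p\<close> is its own preimage, the shifted sequence again satisfies the
  hypothesis, so the lemma can be iterated.\<close>

lemma represents_Minus_fixpoint:
  assumes a: "a > 0" and p: "p < 0" "f_sign a Minus p = p" and "represents a \<epsilon> p"
  shows "\<epsilon> 0 = Minus" and "represents a (\<lambda>k. \<epsilon> (Suc k)) p"
proof -
  let ?v = "u a (\<lambda>k. \<epsilon> (Suc k))"
  have lim: "(\<lambda>n. u a \<epsilon> (Suc n)) \<longlonglongrightarrow> p"
    using \<open>represents a \<epsilon> p\<close> LIMSEQ_Suc by (auto simp: represents_def)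
  show minus: "\<epsilon> 0 = Minus"
  proof (rule ccontr)
    assume "\<epsilon> 0 \<noteq> Minus"
    then have "0 \<le> u a \<epsilon> (Suc n)" for n
      by (cases "\<epsilon> 0") (simp_all add: u_Suc exp_ereal_nonneg)
    then have "0 \<le> p"
      using LIMSEQ_le_const[OF lim] by blast
    with p show False by simp
  qed
  \<comment> \<open>The limit is pulled back through \<open>f_sign a Minus\<close> by order alone:
    the map reverses strict inequalities and fixes \<open>p\<close>, so a bound \<open>y\<close> on
    one side of \<open>p\<close> becomes the bound \<open>f_sign a Minus y\<close> on the
    other.\<close>
  show "represents a (\<lambda>k. \<epsilon> (Suc k)) p"
    unfolding represents_def
  proof (rule order_tendstoI)
    fix y assume "y < p"
    then have "p < f_sign a Minus y"
      using f_sign_Minus_less_iff[OF a] p(2) by metis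
    from order_tendstoD(2)[OF lim this]
    show "\<forall>\<^sub>F n in sequentially. y < ?v n"
      by (simp only: u_Suc minus f_sign_Minus_less_iff[OF a])
  next
    fix y assume "p < y"
    then have "f_sign a Minus y < p"
      using f_sign_Minus_less_iff[OF a] p(2) by metis
    from order_tendstoD(1)[OF lim this]
    show "\<forall>\<^sub>F n in sequentially. ?v n < y"
      by (simp only: u_Suc minus f_sign_Minus_less_iff[OF a])
  qed
qed

lemma represents_Minus_fixpoint_imp_all_Minus:
  assumes "a > 0" "p < 0" "f_sign a Minus p = p" "represents a \<epsilon> p"
  shows "\<epsilon> = (\<lambda>_. Minus)"
proof
  fix n
  show "\<epsilon> n = Minus"
    using assms(4)
  \<comment> \<open>The sign at \<open>Suc n\<close> is the sign at \<open>n\<close> of the shifted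
    sequence, hence the generalisation over \<epsilon>.\<close>
  proof (induction n arbitrary: \<epsilon>)
    case 0
    then show ?case using represents_Minus_fixpoint(1) assms(1-3) by blast
  next
    case (Suc n)
    from Suc.IH[OF represents_Minus_fixpoint(2)[OF assms(1-3) Suc.prems]] show ?case .
  qed
qed

theorem proposition3:
  fixes a :: real
  assumes "a > exp 1"
  shows "(\<exists>\<epsilon>. convergent (u a \<epsilon>)) \<and> (\<exists>\<epsilon>. \<not> convergent (u a \<epsilon>)) \<and>
    (\<exists>t. representable a t) \<and> (\<exists>t. \<not> representable a t) \<and>
    \<not> suitable a"
proof -
  have a: "a > 0" using assms exp_gt_zero less_trans by blast
  obtain p where p: "p < 0" "f_sign a Minus p = p"
    using f_sign_Minus_fixpoint[OF a] .
  have "\<not> representable a p"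
    using represents_Minus_fixpoint_imp_all_Minus[OF a p] not_convergent_u_Minus[OF assms]
    unfolding representable_def represents_def convergent_def by metis
  moreover have "\<exists>t. representable a t"
    using convergent_u_Plus[OF a]
    unfolding representable_def represents_def convergent_def by blast
  ultimately show ?thesis
    using convergent_u_Plus[OF a] not_convergent_u_Minus[OF assms]
    unfolding suitable_def by blast
qed

end
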